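(* Let $\chi$ be a polynomial vector field on $\mathbb{R}^2$ fixing an infinity of lines. Then $\chi$ is either null, central or parallel.
   Context: A polynomial vector field is $\chi=P\partial_x+Q\partial_y$ with $P,Q\in\mathbb{R}[x,y]$; it is null if $P=Q=0$. A line $L\subset\mathbb{R}^2$ with degree-one equation $\alpha_L=0$ is invariant by $\chi$ if it is invariant under the flow of $\chi$, equivalently if $\alpha_L$ divides $\chi\alpha_L$ in $\mathbb{R}[x,y]$. A finite set $\mathcal{A}$ of lines is maximal fixed by $\chi$ if all its lines are invariant by $\chi$ and any line of $\mathbb{R}^2$ invariant by $\chi$ belongs to $\mathcal{A}$; $\chi$ fixes an infinity of lines if there is no such finite maximal set, i.e. if infinitely many lines of $\mathbb{R}^2$ are invariant by $\chi$. A non-null vector field $\chi=P\partial_x+Q\partial_y$ is central if there is a point $(x_0,y_0)\in\mathbb{R}^2$ such that the vectors $(x-x_0,y-y_0)$ and $(P(x,y),Q(x,y))$ are collinear (linearly dependent) for every $(x,y)\in\mathbb{R}^2$. It is parallel if there is a nonzero $v\in\mathbb{R}^2$ such that $v$ and $(P(x,y),Q(x,y))$ are collinear for every $(x,y)\in\mathbb{R}^2$. *)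

theory Defs
  imports "HOL-Analysis.Analysis" "HOL-Computational_Algebra.Computational_Algebra"
begin

text \<open>
  The ring \<open>\<real>[x,y]\<close> is rendered as \<open>\<real>[x][y]\<close>: the outer variable is \<open>y\<close>
  and the coefficients are polynomials in \<open>x\<close>.
\<close>

type_synonym rpoly2 = "real poly poly"

definition const2 :: "real \<Rightarrow> rpoly2" where
  "const2 c = [:[:c:]:]"

definition varX :: rpoly2 where
  "varX = [:[:0, 1:]:]"

definition varY :: rpoly2 where
  "varY = [:0, 1:]"

definition eval2 :: "rpoly2 \<Rightarrow> real \<times> real \<Rightarrow> real" where
  "eval2 f z = poly (poly f [:snd z:]) (fst z)"

definition partialX :: "rpoly2 \<Rightarrow> rpoly2" where
  "partialX f = map_poly pderiv f"

definition partialY :: "rpoly2 \<Rightarrow> rpoly2" where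
  "partialY f = pderiv f"

text \<open>The pair \<open>(P, Q)\<close> stands for \<open>P \<partial>\<^sub>x + Q \<partial>\<^sub>y\<close>.\<close>

type_synonym vfield = "rpoly2 \<times> rpoly2"

definition vf_derivation :: "vfield \<Rightarrow> rpoly2 \<Rightarrow> rpoly2" where
  "vf_derivation \<xi> f = fst \<xi> * partialX f + snd \<xi> * partialY f"

definition vf_at :: "vfield \<Rightarrow> real \<times> real \<Rightarrow> real \<times> real" where
  "vf_at \<xi> z = (eval2 (fst \<xi>) z, eval2 (snd \<xi>) z)"

definition affine_form :: "rpoly2 \<Rightarrow> bool" where
  "affine_form \<alpha> \<longleftrightarrow>
     (\<exists>a b c. (a \<noteq> 0 \<or> b \<noteq> 0) \<and> \<alpha> = const2 a * varX + const2 b * varY + const2 c)"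

definition line_equation :: "rpoly2 \<Rightarrow> (real \<times> real) set \<Rightarrow> bool" where
  "line_equation \<alpha> L \<longleftrightarrow> affine_form \<alpha> \<and> L = {z. eval2 \<alpha> z = 0}"

definition is_line :: "(real \<times> real) set \<Rightarrow> bool" where
  "is_line L \<longleftrightarrow> (\<exists>\<alpha>. line_equation \<alpha> L)"

text \<open>
  Degree-one equations of a given line are unique up to a nonzero scalar, so the
  choice of \<open>\<alpha>\<close> below is immaterial.
\<close>

definition invariant_line :: "vfield \<Rightarrow> (real \<times> real) set \<Rightarrow> bool" where
  "invariant_line \<xi> L \<longleftrightarrow> (\<exists>\<alpha>. line_equation \<alpha> L \<and> \<alpha> dvd vf_derivation \<xi> \<alpha>)"

definition maximal_fixed :: "vfield \<Rightarrow> (real \<times> real) set set \<Rightarrow> bool" where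
  "maximal_fixed \<xi> \<A> \<longleftrightarrow>
     finite \<A> \<and> (\<forall>L\<in>\<A>. is_line L \<and> invariant_line \<xi> L) \<and>
     (\<forall>L. is_line L \<and> invariant_line \<xi> L \<longrightarrow> L \<in> \<A>)"

definition fixes_infinity_of_lines :: "vfield \<Rightarrow> bool" where
  "fixes_infinity_of_lines \<xi> \<longleftrightarrow> \<not> (\<exists>\<A>. maximal_fixed \<xi> \<A>)"

definition null_vf :: "vfield \<Rightarrow> bool" where
  "null_vf \<xi> \<longleftrightarrow> fst \<xi> = 0 \<and> snd \<xi> = 0"

text \<open>
  Two vectors \<open>u\<close>, \<open>v\<close> are linearly dependent iff the points \<open>0\<close>, \<open>u\<close>, \<open>v\<close> are
  collinear; \<open>dependent {u, v}\<close> would be wrong when \<open>u = v\<close>.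
\<close>

definition central_vf :: "vfield \<Rightarrow> bool" where
  "central_vf \<xi> \<longleftrightarrow> \<not> null_vf \<xi> \<and> (\<exists>z0. \<forall>z. collinear {0, z - z0, vf_at \<xi> z})"

definition parallel_vf :: "vfield \<Rightarrow> bool" where
  "parallel_vf \<xi> \<longleftrightarrow> \<not> null_vf \<xi> \<and> (\<exists>v. v \<noteq> 0 \<and> (\<forall>z. collinear {0, v, vf_at \<xi> z}))"

lemma fixes_infinity_of_lines_iff:
  "fixes_infinity_of_lines \<xi> \<longleftrightarrow> infinite {L. is_line L \<and> invariant_line \<xi> L}"
proof -
  have "maximal_fixed \<xi> \<A> \<longleftrightarrow> finite \<A> \<and> \<A> = {L. is_line L \<and> invariant_line \<xi> L}" for \<A>
    unfolding maximal_fixed_def by blast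
  then show ?thesis
    unfolding fixes_infinity_of_lines_def by (simp only: ex_simps simp_thms) metis
qed

lemma eval2_affine_form:
  "eval2 (const2 a * varX + const2 b * varY + const2 c) (x, y) = a * x + b * y + c"
  by (simp add: eval2_def const2_def varX_def varY_def algebra_simps)

lemma vf_derivation_affine_form:
  "vf_derivation (P, Q) (const2 a * varX + const2 b * varY + const2 c)
     = const2 a * P + const2 b * Q"
  by (simp add: vf_derivation_def partialX_def partialY_def const2_def varX_def varY_def
      map_poly_pCons pderiv_pCons algebra_simps)

lemma partialX_has_derivative:
  "((\<lambda>t. eval2 f (t, y)) has_real_derivative eval2 (partialX f) (x, y)) (at x)"
proof (induction f)
  case 0
  then show ?case by (simp add: eval2_def partialX_def)
next
  case (pCons a f)
  have "((\<lambda>t. poly a t + y * eval2 f (t, y)) has_real_derivative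
      poly (pderiv a) x + y * eval2 (partialX f) (x, y)) (at x)"
    by (intro DERIV_add poly_DERIV DERIV_cmult pCons.IH)
  then show ?case
    using pCons.hyps by (simp add: eval2_def partialX_def map_poly_pCons)
qed

lemma partialY_has_derivative:
  "((\<lambda>t. eval2 f (x, t)) has_real_derivative eval2 (partialY f) (x, y)) (at y)"
proof (induction f)
  case 0
  then show ?case by (simp add: eval2_def partialY_def)
next
  case (pCons a f)
  have "((\<lambda>t. poly a x + t * eval2 f (x, t)) has_real_derivative
      0 + (1 * eval2 f (x, y) + eval2 (partialY f) (x, y) * y)) (at y)"
    by (intro DERIV_add DERIV_const DERIV_mult DERIV_ident pCons.IH)
  then show ?case
    by (simp add: eval2_def partialY_def pderiv_pCons algebra_simps)
qed

end

theory Submission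
  imports Defs
begin

text \<open>
  Two distinct invariant lines impose two independent linear conditions on the field at their
  common point, so the field vanishes there. If neither a point nor a direction is shared by
  infinitely many invariant lines, then every invariant line carries infinitely many such points,
  so the field vanishes on infinitely many lines and is null. Otherwise, the determinant of the
  field with \<open>z - z\<^sub>0\<close> (for a shared point) or with \<open>v\<close> (for a shared direction)
  vanishes on infinitely many lines and hence identically.
\<close>

section \<open>Lines in coordinates and evaluation at points\<close>

definition line_set :: "real \<Rightarrow> real \<Rightarrow> real \<Rightarrow> (real \<times> real) set" where
  "line_set a b c = {z. a * fst z + b * snd z + c = 0}"

lemma is_line_iff: "is_line L \<longleftrightarrow> (\<exists>a b c. (a \<noteq> 0 \<or> b \<noteq> 0) \<and> L = line_set a b c)"
  unfolding is_line_def line_equation_def affine_form_def line_set_def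
  by (force simp: eval2_affine_form)

lemma eval2_add [simp]: "eval2 (f + g) z = eval2 f z + eval2 g z"
  by (simp add: eval2_def)

lemma eval2_diff [simp]: "eval2 (f - g) z = eval2 f z - eval2 g z"
  by (simp add: eval2_def)

lemma eval2_mult [simp]: "eval2 (f * g) z = eval2 f z * eval2 g z"
  by (simp add: eval2_def)

lemma eval2_const2 [simp]: "eval2 (const2 c) z = c"
  by (simp add: eval2_def const2_def)

lemma eval2_varX [simp]: "eval2 varX z = fst z"
  by (simp add: eval2_def varX_def)

lemma eval2_varY [simp]: "eval2 varY z = snd z"
  by (simp add: eval2_def varY_def)

lemma eval2_0 [simp]: "eval2 0 z = 0"
  by (simp add: eval2_def)

text \<open>Every constant \<open>[:y:]\<close> is then a root of \<open>f\<close>, read as a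
  polynomial in the outer variable over the integral domain of real polynomials in x; a nonzero
  \<open>f\<close> has only finitely many roots there.\<close>

lemma eval2_eq_0_imp_eq_0:
  assumes "\<And>z. eval2 f z = 0"
  shows "f = 0"
proof (rule ccontr)
  assume "f \<noteq> 0"
  then have "finite {q. poly f q = 0}"
    by (rule poly_roots_finite)
  moreover have "poly f [:y:] = 0" for y
  proof -
    have "poly (poly f [:y:]) x = 0" for x
      using assms[of "(x, y)"] by (simp add: eval2_def)
    then show ?thesis
      using poly_all_0_iff_0 by blast
  qed
  then have "range (\<lambda>y. [:y:]) \<subseteq> {q. poly f q = 0}"
    by auto
  ultimately have "finite (range (\<lambda>y::real. [:y:]))"
    by (rule finite_subset[rotated])
  then show False
    by (simp add: finite_image_iff inj_def infinite_UNIV_char_0)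
qed

section \<open>Polynomials vanishing on lines\<close>

lemma eval2_along_line:
  "\<exists>g. \<forall>t. poly g t = eval2 f (p + t *\<^sub>R d)"
proof (induction f)
  case 0
  then show ?case by (auto intro: exI[of _ 0])
next
  case (pCons a f)
  then obtain g where g: "\<And>t. poly g t = eval2 f (p + t *\<^sub>R d)"
    by blast
  \<comment> \<open>Horner step: the line is substituted for x in the coefficient \<open>a\<close>,
    and the outer variable becomes the second coordinate of the line.\<close>
  have "poly (pcompose a [:fst p, fst d:] + [:snd p, snd d:] * g) t
      = eval2 (pCons a f) (p + t *\<^sub>R d)" for t
    using g[of t] by (simp add: eval2_def poly_pcompose algebra_simps)
  then show ?case by blast
qed

lemma line_set_eq_range:
  assumes "a \<noteq> 0 \<or> b \<noteq> 0"
  obtains p where "line_set a b c = range (\<lambda>t. p + t *\<^sub>R (- b, a))"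
proof -
  define n where "n = a\<^sup>2 + b\<^sup>2"
  have n: "n \<noteq> 0"
    using assms by (simp add: n_def sum_power2_eq_zero_iff)
  \<comment> \<open>The foot of the perpendicular from the origin.\<close>
  define p where "p = (- a * c / n, - b * c / n)"
  have "a * fst p + b * snd p + c = 0"
    using n by (simp add: p_def field_simps) (simp add: n_def power2_eq_square algebra_simps)
  then have sub: "range (\<lambda>t. p + t *\<^sub>R (- b, a)) \<subseteq> line_set a b c"
    by (auto simp: line_set_def algebra_simps)
  have "z \<in> range (\<lambda>t. p + t *\<^sub>R (- b, a))" if "z \<in> line_set a b c" for z
  proof -
    obtain x y where z: "z = (x, y)" by fastforce
    have c: "c = - a * x - b * y"
      using that by (simp add: z line_set_def)
    \<comment> \<open>As \<open>p\<close> is orthogonal to \<open>(- b, a)\<close>, the parameter of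
      \<open>z\<close> is its scalar product with that vector over the squared length
      \<open>n\<close>.\<close>
    have "z = p + ((a * y - b * x) / n) *\<^sub>R (- b, a)"
      using n by (simp add: z p_def c field_simps) (simp add: n_def power2_eq_square algebra_simps)
    then show ?thesis by blast
  qed
  with sub show thesis
    using that[of p] by blast
qed

lemma vanishes_on_line:
  assumes "is_line L" and "infinite {z \<in> L. eval2 f z = 0}" and "z \<in> L"
  shows "eval2 f z = 0"
proof -
  obtain a b c where "a \<noteq> 0 \<or> b \<noteq> 0" "L = line_set a b c"
    using assms(1) by (auto simp: is_line_iff)
  then obtain p d where L: "L = range (\<lambda>t. p + t *\<^sub>R d)"
    using line_set_eq_range by metis
  obtain g where g: "\<And>t. poly g t = eval2 f (p + t *\<^sub>R d)"
    using eval2_along_line by blast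
  have "{z \<in> L. eval2 f z = 0} \<subseteq> (\<lambda>t. p + t *\<^sub>R d) ` {t. poly g t = 0}"
    by (auto simp: L g)
  then have "infinite {t. poly g t = 0}"
    using assms(2) finite_surj by blast
  then have "g = 0"
    using poly_roots_finite by blast
  then show ?thesis
    using assms(3) g by (auto simp: L)
qed

text \<open>A line that avoids \<open>z\<close> is determined by its traces on the two axes through \<open>z\<close>.\<close>

lemma line_eq_if_traces_eq:
  assumes "is_line L" "is_line M" "(x, y) \<notin> L" "(x, y) \<notin> M"
    and "L \<inter> line_set 1 0 (- x) = M \<inter> line_set 1 0 (- x)"
    and "L \<inter> line_set 0 1 (- y) = M \<inter> line_set 0 1 (- y)"
  shows "L = M"
proof -
  \<comment> \<open>The equation takes a nonzero value \<open>k\<close> at \<open>(x, y)\<close>.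
    Dividing by \<open>- k\<close> leaves only two coefficients to recover, one from each
    axis.\<close>
  have normal_form: "\<exists>a b. N = {z. a * (fst z - x) + b * (snd z - y) = 1}"
    if "is_line N" "(x, y) \<notin> N" for N
  proof -
    obtain a b c where N: "N = line_set a b c"
      using \<open>is_line N\<close> by (auto simp: is_line_iff)
    define k where "k = a * x + b * y + c"
    have "k \<noteq> 0"
      using that(2) by (simp add: N k_def line_set_def)
    have "(- a / k) * (u - x) + (- b / k) * (v - y) = 1 \<longleftrightarrow> a * u + b * v + c = 0" for u v
    proof -
      have "(- a / k) * (u - x) + (- b / k) * (v - y) = - (a * (u - x) + b * (v - y)) / k"
        by (simp add: add_divide_distrib diff_divide_distrib)
      also have "\<dots> = 1 \<longleftrightarrow> a * u + b * v + c = 0"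
        using \<open>k \<noteq> 0\<close> by (simp add: divide_eq_eq) (auto simp: k_def algebra_simps)
      finally show ?thesis .
    qed
    then have "N = {z. (- a / k) * (fst z - x) + (- b / k) * (snd z - y) = 1}"
      by (simp only: N line_set_def)
    then show ?thesis by blast
  qed
  obtain a b where L: "L = {z. a * (fst z - x) + b * (snd z - y) = 1}"
    using normal_form assms(1,3) by blast
  obtain a' b' where M: "M = {z. a' * (fst z - x) + b' * (snd z - y) = 1}"
    using normal_form assms(2,4) by blast
  have "a * u = 1 \<longleftrightarrow> a' * u = 1" for u
  proof -
    have "(x + u, y) \<in> L \<longleftrightarrow> (x + u, y) \<in> M"
      using assms(6) by (auto simp: line_set_def set_eq_iff)
    then show ?thesis by (simp add: L M)
  qed
  \<comment> \<open>The trace is the single point \<open>u = 1 / a\<close>, or empty if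
    \<open>a = 0\<close>; testing both reciprocals covers the case where one coefficient is
    zero.\<close>
  from this[of "1 / a"] this[of "1 / a'"] have "a = a'"
    by (cases "a = 0"; cases "a' = 0") (auto simp: field_simps)
  have "b * u = 1 \<longleftrightarrow> b' * u = 1" for u
  proof -
    have "(x, y + u) \<in> L \<longleftrightarrow> (x, y + u) \<in> M"
      using assms(5) by (auto simp: line_set_def set_eq_iff)
    then show ?thesis by (simp add: L M)
  qed
  from this[of "1 / b"] this[of "1 / b'"] have "b = b'"
    by (cases "b = 0"; cases "b' = 0") (auto simp: field_simps)
  with \<open>a = a'\<close> show ?thesis by (simp add: L M)
qed

text \<open>If \<open>f\<close> is nonzero at \<open>z\<close>, all lines of \<open>S\<close> miss
  \<open>z\<close>, so their traces on the two axes through \<open>z\<close> determine them. These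
  traces consist of zeros of \<open>f\<close>, and each axis carries only finitely many, so
  \<open>S\<close> would embed in a finite set.\<close>

lemma vanishes_on_infinitely_many_lines:
  assumes "infinite S" and line: "\<And>L. L \<in> S \<Longrightarrow> is_line L"
    and zero: "\<And>L z. L \<in> S \<Longrightarrow> z \<in> L \<Longrightarrow> eval2 f z = 0"
  shows "f = 0"
proof (rule eval2_eq_0_imp_eq_0, rule ccontr)
  fix z
  assume nz: "eval2 f z \<noteq> 0"
  obtain x y where z: "z = (x, y)" by fastforce
  define V H where "V = line_set 1 0 (- x)" and "H = line_set 0 1 (- y)"
  have "is_line V" "is_line H"
    unfolding is_line_iff V_def H_def by (metis zero_neq_one)+
  moreover have "z \<in> V" "z \<in> H"
    by (simp_all add: V_def H_def z line_set_def)
  ultimately have fin: "finite {w \<in> V. eval2 f w = 0}" "finite {w \<in> H. eval2 f w = 0}"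
    using vanishes_on_line[of V f z] vanishes_on_line[of H f z] nz by auto
  have "inj_on (\<lambda>L. (L \<inter> V, L \<inter> H)) S"
  proof (rule inj_onI)
    fix L M
    assume *: "L \<in> S" "M \<in> S" "(L \<inter> V, L \<inter> H) = (M \<inter> V, M \<inter> H)"
    then have "z \<notin> L" "z \<notin> M"
      using zero nz by blast+
    with * show "L = M"
      using line_eq_if_traces_eq[of L M x y] line by (simp add: V_def H_def z)
  qed
  moreover have "(\<lambda>L. (L \<inter> V, L \<inter> H)) ` S
      \<subseteq> Pow {w \<in> V. eval2 f w = 0} \<times> Pow {w \<in> H. eval2 f w = 0}"
    using zero by auto
  ultimately show False
    using \<open>infinite S\<close> fin by (meson finite_Pow_iff finite_SigmaI finite_imageD finite_subset)
qed

section \<open>The field along invariant lines\<close>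

text \<open>Evaluating the divisibility on \<open>L\<close> makes the field orthogonal to the normal
  of \<open>L\<close> there. All later arguments use invariance in this form.\<close>

lemma invariant_lineE:
  assumes "invariant_line (P, Q) L"
  obtains a b c where "a \<noteq> 0 \<or> b \<noteq> 0" "L = line_set a b c"
    "\<And>z. z \<in> L \<Longrightarrow> a * eval2 P z + b * eval2 Q z = 0"
proof -
  obtain \<alpha> where \<alpha>: "line_equation \<alpha> L" "\<alpha> dvd vf_derivation (P, Q) \<alpha>"
    using assms by (auto simp: invariant_line_def)
  then obtain a b c where abc: "a \<noteq> 0 \<or> b \<noteq> 0"
      "\<alpha> = const2 a * varX + const2 b * varY + const2 c"
    by (auto simp: line_equation_def affine_form_def)
  have L: "L = {z. eval2 \<alpha> z = 0}"
    using \<alpha>(1) by (simp add: line_equation_def)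
  obtain k where k: "const2 a * P + const2 b * Q = \<alpha> * k"
    using \<alpha>(2) by (auto simp: abc(2) vf_derivation_affine_form)
  have "a * eval2 P z + b * eval2 Q z = 0" if "z \<in> L" for z
    using that arg_cong[OF k, of "\<lambda>h. eval2 h z"] by (simp add: L)
  then show thesis
    using abc(1) by (intro that[of a b c]) (auto simp: L abc(2) line_set_def)
qed

text \<open>In the plane, the vectors orthogonal to a nonzero \<open>(a, b)\<close> form a space of
  dimension one.\<close>

lemma det_eq_0_if_orthogonal:
  fixes a b :: real
  assumes "a \<noteq> 0 \<or> b \<noteq> 0" "a * u1 + b * u2 = 0" "a * w1 + b * w2 = 0"
  shows "u1 * w2 - u2 * w1 = 0"
proof -
  have "a * (u1 * w2 - u2 * w1) = 0" "b * (u1 * w2 - u2 * w1) = 0"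
    using assms(2,3) by algebra+
  with assms(1) show ?thesis by auto
qed

lemma vanishes_at_intersection:
  assumes "invariant_line (P, Q) L" "invariant_line (P, Q) M" "L \<noteq> M" "z \<in> L" "z \<in> M"
  shows "eval2 P z = 0 \<and> eval2 Q z = 0"
proof -
  obtain a b c where L: "a \<noteq> 0 \<or> b \<noteq> 0" "L = line_set a b c"
      "a * eval2 P z + b * eval2 Q z = 0"
    using assms(1,4) by (metis invariant_lineE)
  obtain a' b' c' where M: "a' \<noteq> 0 \<or> b' \<noteq> 0" "M = line_set a' b' c'"
      "a' * eval2 P z + b' * eval2 Q z = 0"
    using assms(2,5) by (metis invariant_lineE)
  \<comment> \<open>Two lines through \<open>z\<close> with proportional normals coincide; hence the
    normals of \<open>L\<close> and \<open>M\<close> are independent.\<close>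
  have sub: "w \<in> line_set r' s' t'"
    if "r \<noteq> 0 \<or> s \<noteq> 0" "z \<in> line_set r s t" "z \<in> line_set r' s' t'"
      "r * s' = s * r'" "w \<in> line_set r s t" for r s t r' s' t' w
  proof -
    have *: "r * (fst w - fst z) + s * (snd w - snd z) = 0"
      using that by (simp add: line_set_def algebra_simps)
    have "r * (r' * (fst w - fst z) + s' * (snd w - snd z)) = 0"
      "s * (r' * (fst w - fst z) + s' * (snd w - snd z)) = 0"
      using * that(4) by algebra+
    then have "r' * (fst w - fst z) + s' * (snd w - snd z) = 0"
      using that(1) by auto
    then show ?thesis
      using that(3) by (simp add: line_set_def algebra_simps)
  qed
  have "a * b' - b * a' \<noteq> 0"
  proof
    assume "a * b' - b * a' = 0"
    then have "L = M"
      using sub[of a b c a' b' c'] sub[of a' b' c' a b c] L M assms(4,5)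
      by (auto simp: algebra_simps)
    with \<open>L \<noteq> M\<close> show False by simp
  qed
  moreover have "(a * b' - b * a') * eval2 P z = 0" "(a * b' - b * a') * eval2 Q z = 0"
    using L(3) M(3) by algebra+
  ultimately show ?thesis by simp
qed

lemma line_sets_meet:
  assumes "r * b \<noteq> s * a"
  shows "line_set a b c \<inter> line_set r s t \<noteq> {}"
proof -
  have d: "a * s - b * r \<noteq> 0"
    using assms by (simp add: algebra_simps)
  \<comment> \<open>Cramer's rule for the two line equations.\<close>
  have "((b * t - c * s) / (a * s - b * r), (c * r - a * t) / (a * s - b * r))
      \<in> line_set a b c \<inter> line_set r s t"
    using d by (simp add: line_set_def divide_simps) (simp add: algebra_simps)
  then show ?thesis by blast
qed

lemma collinear_0_if_det_eq_0:
  fixes u w :: "real \<times> real"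
  assumes "fst u * snd w - snd u * fst w = 0"
  shows "collinear {0, u, w}"
proof (cases "u = 0")
  case True
  then show ?thesis by (simp add: collinear_lemma)
next
  case False
  obtain u1 u2 w1 w2 where uw: "u = (u1, u2)" "w = (w1, w2)" by fastforce
  have det: "u1 * w2 = u2 * w1"
    using assms by (simp add: uw)
  have "\<exists>k. w = k *\<^sub>R u"
  proof (cases "u1 = 0")
    case True
    with False det show ?thesis
      by (intro exI[of _ "w2 / u2"]) (auto simp: uw zero_prod_def)
  next
    case False
    with det show ?thesis
      by (intro exI[of _ "w1 / u1"]) (auto simp: uw field_simps)
  qed
  then show ?thesis by (auto simp: collinear_lemma)
qed

lemma vf_at_collinear_if_det_eq_0:
  assumes "F * Q - G * P = 0"
  shows "collinear {0, (eval2 F z, eval2 G z), vf_at (P, Q) z}"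
  using arg_cong[OF assms, of "\<lambda>h. eval2 h z"]
  by (intro collinear_0_if_det_eq_0) (simp add: vf_at_def)

text \<open>Every line of \<open>T\<close> meets \<open>L\<close> in a zero of the field, and each
  such zero lies on finitely many lines of \<open>T\<close>. So \<open>L\<close> carries infinitely
  many zeros.\<close>

lemma vanishes_if_meets_infinitely_many:
  assumes "is_line L" "invariant_line (P, Q) L" "infinite T"
    and T: "\<And>M. M \<in> T \<Longrightarrow> invariant_line (P, Q) M \<and> M \<noteq> L \<and> L \<inter> M \<noteq> {}"
    and fin: "\<And>z. finite {M \<in> T. z \<in> M}"
    and "z \<in> L"
  shows "eval2 P z = 0 \<and> eval2 Q z = 0"
proof -
  define Z where "Z = {z \<in> L. eval2 P z = 0 \<and> eval2 Q z = 0}"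
  have "T \<subseteq> (\<Union>z\<in>Z. {M \<in> T. z \<in> M})"
    using T vanishes_at_intersection[OF assms(2)] unfolding Z_def by blast
  then have "infinite Z"
    using \<open>infinite T\<close> fin by (meson finite_UN_I finite_subset)
  then have "infinite {z \<in> L. eval2 P z = 0}" "infinite {z \<in> L. eval2 Q z = 0}"
    by (rule infinite_super[rotated]; auto simp: Z_def)+
  then show ?thesis
    using vanishes_on_line assms(1) \<open>z \<in> L\<close> by blast
qed

theorem theorem3p9:
  fixes \<xi> :: vfield
  assumes "fixes_infinity_of_lines \<xi>"
  shows "null_vf \<xi> \<or> central_vf \<xi> \<or> parallel_vf \<xi>"
proof -
  obtain P Q where \<xi>: "\<xi> = (P, Q)" by fastforce
  define S where "S = {L. is_line L \<and> invariant_line \<xi> L}"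
  have inf: "infinite S"
    using assms by (simp add: S_def fixes_infinity_of_lines_iff)
  have S: "is_line L" "invariant_line (P, Q) L" if "L \<in> S" for L
    using that by (auto simp: S_def \<xi>)
  \<comment> \<open>For nonzero \<open>v\<close>, the lines of \<open>S\<close> with direction
    \<open>v\<close>, expressed by translation so that no equation has to be chosen.\<close>
  define D where "D v = {L \<in> S. \<forall>z\<in>L. z + v \<in> L}" for v
  consider z0 where "infinite {L \<in> S. z0 \<in> L}" | v where "v \<noteq> 0" "infinite (D v)"
    | "\<And>z. finite {L \<in> S. z \<in> L}" "\<And>v. v \<noteq> 0 \<Longrightarrow> finite (D v)"
    by blast
  then show ?thesis
  proof cases
    case 1
    have "(varX - const2 (fst z0)) * Q - (varY - const2 (snd z0)) * P = 0"
    proof (rule vanishes_on_infinitely_many_lines[OF 1])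
      fix L z
      assume L: "L \<in> {L \<in> S. z0 \<in> L}" "z \<in> L"
      then obtain a b c where abc: "a \<noteq> 0 \<or> b \<noteq> 0" "L = line_set a b c"
          "a * eval2 P z + b * eval2 Q z = 0"
        using S(2) by (metis (no_types, lifting) invariant_lineE mem_Collect_eq)
      \<comment> \<open>Both points lie on \<open>L\<close>, so \<open>z - z0\<close> is orthogonal
        to the normal, as is the field at \<open>z\<close>.\<close>
      have "a * (fst z - fst z0) + b * (snd z - snd z0) = 0"
        using L abc(2) by (simp add: line_set_def algebra_simps)
      from det_eq_0_if_orthogonal[OF abc(1) this abc(3)]
      show "eval2 ((varX - const2 (fst z0)) * Q - (varY - const2 (snd z0)) * P) z = 0"
        by simp
    qed (use S in auto)
    from vf_at_collinear_if_det_eq_0[OF this]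
    have "collinear {0, z - z0, vf_at \<xi> z}" for z
      by (simp add: \<xi> minus_prod_def)
    then show ?thesis unfolding central_vf_def by blast
  next
    case 2
    have "const2 (fst v) * Q - const2 (snd v) * P = 0"
    proof (rule vanishes_on_infinitely_many_lines[OF 2(2)])
      fix L z
      assume L: "L \<in> D v" "z \<in> L"
      then obtain a b c where abc: "a \<noteq> 0 \<or> b \<noteq> 0" "L = line_set a b c"
          "a * eval2 P z + b * eval2 Q z = 0"
        using S(2) unfolding D_def by (metis (no_types, lifting) invariant_lineE mem_Collect_eq)
      have "z + v \<in> L"
        using L by (simp add: D_def)
      with L(2) have "a * fst v + b * snd v = 0"
        by (simp add: abc(2) line_set_def algebra_simps)
      from det_eq_0_if_orthogonal[OF abc(1) this abc(3)]
      show "eval2 (const2 (fst v) * Q - const2 (snd v) * P) z = 0"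
        by simp
    qed (use S in \<open>auto simp: D_def\<close>)
    from vf_at_collinear_if_det_eq_0[OF this]
    have "collinear {0, v, vf_at \<xi> z}" for z
      by (simp add: \<xi>)
    with 2(1) show ?thesis unfolding parallel_vf_def by blast
  next
    case 3
    have "eval2 P z = 0 \<and> eval2 Q z = 0" if L: "L \<in> S" "z \<in> L" for L z
    proof -
      obtain a b c where abc: "a \<noteq> 0 \<or> b \<noteq> 0" "L = line_set a b c"
        using S(1)[OF L(1)] by (auto simp: is_line_iff)
      then have v: "(- b, a) \<noteq> 0" by (auto simp: zero_prod_def)
      \<comment> \<open>The direction of \<open>L\<close> is \<open>(- b, a)\<close>. Discarding the
        finitely many lines of \<open>S\<close> with this direction, \<open>L\<close> among them,
        leaves infinitely many that cross \<open>L\<close>.\<close>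
      have "M \<noteq> L \<and> L \<inter> M \<noteq> {}" if M: "M \<in> S" "M \<notin> D (- b, a)" for M
      proof -
        obtain r s t where rst: "M = line_set r s t"
          using S(1)[OF M(1)] by (auto simp: is_line_iff)
        have "r * b \<noteq> s * a"
          using M by (auto simp: D_def rst line_set_def algebra_simps)
        then have "L \<inter> M \<noteq> {}"
          unfolding abc(2) rst by (rule line_sets_meet)
        moreover have "L \<in> D (- b, a)"
          using L(1) by (auto simp: D_def abc(2) line_set_def algebra_simps)
        ultimately show ?thesis
          using M(2) by auto
      qed
      moreover have "infinite (S - D (- b, a))"
        using inf 3(2)[OF v] by (simp add: Diff_infinite_finite)
      moreover have "finite {M \<in> S - D (- b, a). z \<in> M}" for z
        using 3(1)[of z] by (rule rev_finite_subset) auto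
      ultimately show ?thesis
        using vanishes_if_meets_infinitely_many[of L P Q "S - D (- b, a)" z] S L by auto
    qed
    then have "P = 0" "Q = 0"
      using vanishes_on_infinitely_many_lines[OF inf S(1)] by blast+
    then show ?thesis by (simp add: null_vf_def \<xi>)
  qed
qed

end
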